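(* For any distant pattern $q$, there exists a constant $c_q>0$ such that $$\sqrt[n]{|\operatorname{Av}_n(q)|}\longrightarrow c_q \quad\text{as } n\to\infty.$$
   Context: A distant pattern is an expression $q=\square^{r_0}q_1\square^{r_1}q_2\square^{r_2}\cdots\square^{r_{k-1}}q_k\square^{r_k}$, where $r_0,\dots,r_k$ are non-negative integers and $q_1q_2\cdots q_k\in S_k$ is a permutation of $\{1,\dots,k\}$; some of the gaps between consecutive letters $q_i,q_{i+1}$ may be designated as tight (indicated by underlining). The pattern is called classical if it has no tight gaps and vincular if it has at least one. An occurrence of $q$ in a permutation $\pi=\pi_1\cdots\pi_n$ of $[n]=\{1,\dots,n\}$ is given by positions $x_1<\cdots<x_k$ such that $\pi_{x_1}\cdots\pi_{x_k}$ is in the same relative order as $q_1\cdots q_k$, at least $r_0$ entries of $\pi$ precede $\pi_{x_1}$, at least $r_k$ entries follow $\pi_{x_k}$, and, for $1\le i\le k-1$, the number of entries strictly between $\pi_{x_i}$ and $\pi_{x_{i+1}}$ is at least $r_i$, and exactly $r_i$ if that gap is tight. $\operatorname{Av}_n(q)$ is the set of permutations of $[n]$ with no occurrence of $q$.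
   Formalization: The pattern must have length k ≥ 2 (for k = 1 the limit is 0), and for vincular patterns the limit is shown to exist only in (0, ∞], since it is infinite e.g. for the fully tight pattern 123; a finite constant c_q > 0 is proved for all classical distant patterns. *)

theory Defs
  imports Complex_Main "HOL-Library.Extended_Real" "HOL-Combinatorics.Permutations"
begin

text \<open>
  Permutations of \<open>{1..n}\<close> are functions that permute \<open>{1..n}\<close>, so that \<open>\<pi> x\<close> is the entry
  in position \<open>x\<close>; positions are numbered from 1.

  A pattern consists of its length \<open>k\<close>, the letters \<open>q\<^sub>1 \<dots> q\<^sub>k\<close>, the gap sizes \<open>r\<^sub>0, \<dots>, r\<^sub>k\<close>
  and the set of those \<open>i\<close> for which the gap between \<open>q\<^sub>i\<close> and \<open>q\<^sub>i\<^sub>+\<^sub>1\<close> is tight.  Gap sizes at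
  indices above \<open>k\<close> carry no meaning.
\<close>

record distant_pattern =
  len :: nat
  letter :: "nat \<Rightarrow> nat"
  gap :: "nat \<Rightarrow> nat"
  tight :: "nat set"

definition is_distant_pattern :: "distant_pattern \<Rightarrow> bool" where
  "is_distant_pattern q \<longleftrightarrow>
     1 \<le> len q \<and> letter q permutes {1..len q} \<and> tight q \<subseteq> {1..<len q}"

definition classical :: "distant_pattern \<Rightarrow> bool" where
  "classical q \<longleftrightarrow> tight q = {}"

definition occurrence :: "distant_pattern \<Rightarrow> nat \<Rightarrow> (nat \<Rightarrow> nat) \<Rightarrow> (nat \<Rightarrow> nat) \<Rightarrow> bool" where
  "occurrence q n \<pi> x \<longleftrightarrow>
     strict_mono_on {1..len q} x \<and>
     x ` {1..len q} \<subseteq> {1..n} \<and>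
     (\<forall>i\<in>{1..len q}. \<forall>j\<in>{1..len q}. \<pi> (x i) < \<pi> (x j) \<longleftrightarrow> letter q i < letter q j) \<and>
     gap q 0 \<le> card {1..<x 1} \<and>
     gap q (len q) \<le> card {x (len q)<..n} \<and>
     (\<forall>i\<in>{1..<len q}. gap q i \<le> card {x i<..<x (i + 1)}) \<and>
     (\<forall>i\<in>tight q. card {x i<..<x (i + 1)} = gap q i)"

definition Av :: "nat \<Rightarrow> distant_pattern \<Rightarrow> (nat \<Rightarrow> nat) set" where
  "Av n q = {\<pi>. \<pi> permutes {1..n} \<and> \<not> (\<exists>x. occurrence q n \<pi> x)}"

end

theory Submission
  imports Defs "HOL-Library.FuncSet" "HOL-Library.Infinite_Set" "HOL-Analysis.Extended_Real_Limits"
begin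

text \<open>
  Discarding the outer gaps of \<open>q\<close> changes the number of avoiders only by a polynomial factor:
  a permutation avoids \<open>q\<close> iff its restriction to the middle positions avoids the trimmed
  pattern.  For the trimmed pattern either the direct sum or the skew sum of two avoiders is again
  an avoider, so the counts are supermultiplicative and Fekete's lemma gives the limit.  For
  classical \<open>q\<close> the limit is finite by the Stanley--Wilf theorem, applied to an inflation of \<open>q\<close>;
  that theorem follows from the bound of Marcus and Tardos by Klazar's contraction argument.
\<close>

subsection \<open>The Marcus--Tardos theorem\<close>

text \<open>The outer gaps obstruct supermultiplicativity: an occurrence of \<open>q\<close> in a
  sum can lie in one summand and borrow entries of the other to fill \<open>gap q 0\<close> or
  \<open>gap q (len q)\<close>. Inner gaps are harmless, tight or not, because a summand occupies
  consecutive positions and everything between two of them belongs to it. After trimming, only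
  occurrences meeting both summands remain to be excluded, and such an occurrence has its first
  letter in the left summand and its last letter in the right one. Trimming is cheap because a fixed
  number \<open>R\<close> of positions is affected: it costs a factor of at most
  \<open>n ^ R\<close>, whose n-th root tends to 1. Finiteness of the limit is where tight gaps
  matter: a copy of an inflation guarantees that gaps are large, never that they have an exact
  size.\<close>

definition mat_contains :: "nat \<Rightarrow> (nat \<Rightarrow> nat) \<Rightarrow> (nat \<times> nat) set \<Rightarrow> bool" where
  "mat_contains k p A \<longleftrightarrow>
     (\<exists>f g. strict_mono_on {..<k} f \<and> strict_mono_on {..<k} g \<and> (\<forall>i<k. (f i, g (p i)) \<in> A))"

lemma mat_containsE:
  assumes "mat_contains k p A"
  obtains f g where "strict_mono_on {..<k} f" "strict_mono_on {..<k} g"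
    "\<forall>i<k. (f i, g (p i)) \<in> A"
  using assms unfolding mat_contains_def by blast

definition contract :: "nat \<Rightarrow> (nat \<times> nat) set \<Rightarrow> (nat \<times> nat) set" where
  "contract s A = (\<lambda>(x, y). (x div s, y div s)) ` A"

definition block :: "nat \<Rightarrow> (nat \<times> nat) set \<Rightarrow> nat \<Rightarrow> nat \<Rightarrow> (nat \<times> nat) set" where
  "block s A I J = {(x, y) \<in> A. x div s = I \<and> y div s = J}"

text \<open>Division by \<open>s\<close> is monotone, so entries taken from blocks with increasing
  indices cannot be out of order, wherever they sit inside their blocks.\<close>

lemma strict_mono_on_if_div:
  fixes f h :: "nat \<Rightarrow> nat"
  assumes "strict_mono_on S h" "\<And>i. i \<in> S \<Longrightarrow> f i div s = h i"
  shows "strict_mono_on S f"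
proof (rule strict_mono_onI)
  fix i j assume "i \<in> S" "j \<in> S" "i < j"
  then have "f i div s < f j div s" using assms by (simp add: strict_mono_on_def)
  then show "f i < f j" by (meson div_le_mono leD not_le_imp_less)
qed

text \<open>A permutation pattern uses each block row and each block column exactly once, so any
  entry of each nonempty block will do: no two choices have to agree on a row or a column.\<close>

lemma mat_contains_contract:
  assumes p: "bij_betw p {..<k} {..<k}" and "mat_contains k p (contract s A)"
  shows "mat_contains k p A"
proof -
  obtain f g where f: "strict_mono_on {..<k} f" and g: "strict_mono_on {..<k} g"
    and fg: "\<forall>i<k. (f i, g (p i)) \<in> contract s A"
    using assms(2) by (rule mat_containsE)
  have "\<forall>i\<in>{..<k}. \<exists>z. z \<in> A \<and> fst z div s = f i \<and> snd z div s = g (p i)"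
    using fg unfolding contract_def by fastforce
  then obtain z where z: "\<And>i. i < k \<Longrightarrow> z i \<in> A \<and> fst (z i) div s = f i \<and> snd (z i) div s = g (p i)"
    by (metis lessThan_iff)
  \<comment> \<open>The only point of the pattern in column \<open>j\<close> is the one in row
    \<open>r j\<close>, so it alone decides which column is chosen for \<open>j\<close>.\<close>
  define r where "r = the_inv_into {..<k} p"
  have r: "r j < k" "p (r j) = j" if "j < k" for j
    using p that unfolding r_def bij_betw_def
    by (metis f_the_inv_into_f lessThan_iff order_refl the_inv_into_into)+
  have rp: "r (p i) = i" if "i < k" for i
    using p that unfolding r_def bij_betw_def by (simp add: the_inv_into_f_f)
  have "strict_mono_on {..<k} (\<lambda>i. fst (z i))"
    using z by (intro strict_mono_on_if_div[OF f, of _ s]) auto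
  moreover have "strict_mono_on {..<k} (\<lambda>j. snd (z (r j)))"
    using z r by (intro strict_mono_on_if_div[OF g, of _ s]) auto
  ultimately show ?thesis
    unfolding mat_contains_def using z rp
    by (intro exI[of _ "\<lambda>i. fst (z i)"] exI[of _ "\<lambda>j. snd (z (r j))"]) auto
qed

text \<open>Transposition carries the bound on blocks with many columns over to blocks with many
  rows, so the pigeonhole argument is needed only once.\<close>

lemma mat_contains_converse:
  assumes p: "bij_betw p {..<k} {..<k}" and "mat_contains k (the_inv_into {..<k} p) (A\<inverse>)"
  shows "mat_contains k p A"
proof -
  obtain f g where f: "strict_mono_on {..<k} f" and g: "strict_mono_on {..<k} g"
    and fg: "\<forall>i<k. (f i, g (the_inv_into {..<k} p i)) \<in> A\<inverse>"
    using assms(2) by (rule mat_containsE)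
  have "(g i, f (p i)) \<in> A" if "i < k" for i
  proof -
    have "p i < k" "the_inv_into {..<k} p (p i) = i"
      using p that by (auto simp: bij_betw_def the_inv_into_f_f)
    then show ?thesis using fg[rule_format, of "p i"] by simp
  qed
  then show ?thesis unfolding mat_contains_def using f g by blast
qed

lemma block_subset:
  assumes "0 < s"
  shows "block s A I J \<subseteq> {I * s..<I * s + s} \<times> {J * s..<J * s + s}"
  using assms by (auto simp: block_def dividend_less_div_times add.commute)

text \<open>If \<open>k\<close> blocks of one block column meet the same \<open>k\<close> columns, then they contain every
  pattern of length \<open>k\<close>.\<close>

lemma card_wide_blocks:
  fixes J :: nat
  assumes p: "bij_betw p {..<k} {..<k}" and nc: "\<not> mat_contains k p A"
    and "finite A" "0 < k" "0 < s"
  defines "W \<equiv> {I. k \<le> card (snd ` block s A I J)}"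
  shows "finite W \<and> card W \<le> k * 2 ^ s"
proof -
  have finB: "finite (block s A I J)" for I
    using \<open>finite A\<close> by (auto simp: block_def intro: finite_subset)
  have "W \<subseteq> (\<lambda>(x, y). x div s) ` A"
  proof
    fix I assume "I \<in> W"
    then have "block s A I J \<noteq> {}" using \<open>0 < k\<close> unfolding W_def by fastforce
    then show "I \<in> (\<lambda>(x, y). x div s) ` A" by (auto simp: block_def)
  qed
  then have finW: "finite W" using \<open>finite A\<close> finite_surj by blast
  \<comment> \<open>Cutting the occupied columns down to exactly \<open>k\<close> prepares the
    pigeonhole: the sets \<open>C I\<close> are among the at most \<open>2 ^ s\<close> subsets of
    the \<open>s\<close> columns.\<close>
  have "\<forall>I\<in>W. \<exists>D. D \<subseteq> snd ` block s A I J \<and> card D = k \<and> finite D"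
    unfolding W_def by (metis mem_Collect_eq obtain_subset_with_card_n)
  then obtain C where C: "\<And>I. I \<in> W \<Longrightarrow> C I \<subseteq> snd ` block s A I J"
    and cC: "\<And>I. I \<in> W \<Longrightarrow> card (C I) = k \<and> finite (C I)"
    by metis
  have CP: "C ` W \<subseteq> Pow {J * s..<J * s + s}"
    using C block_subset[OF \<open>0 < s\<close>, of A _ J] by fastforce
  \<comment> \<open>If \<open>k\<close> blocks share the column set \<open>D\<close>, the i-th of
    them in increasing order supplies an entry in the \<open>p i\<close>-th column of
    \<open>D\<close>.\<close>
  have fib: "card {I \<in> W. C I = D} \<le> k" if "D \<in> C ` W" for D
  proof (rule ccontr)
    assume "\<not> ?thesis"
    then obtain F where F: "F \<subseteq> {I \<in> W. C I = D}" "card F = k" "finite F"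
      by (meson nat_le_linear obtain_subset_with_card_n)
    obtain e where e: "bij_betw e {..<k} F" "strict_mono_on {..<k} e"
      using ex_bij_betw_strict_mono_card[OF F(3)] F(2) by metis
    have D: "finite D" "card D = k" using that cC by auto
    obtain g where g: "bij_betw g {..<k} D" "strict_mono_on {..<k} g"
      using ex_bij_betw_strict_mono_card[OF D(1)] D(2) by metis
    have "\<forall>i\<in>{..<k}. \<exists>x. (x, g (p i)) \<in> A \<and> x div s = e i"
    proof
      fix i assume i: "i \<in> {..<k}"
      have "g (p i) \<in> D" using g p i by (auto simp: bij_betw_def)
      moreover have "e i \<in> W" "C (e i) = D" using e F i by (auto simp: bij_betw_def)
      ultimately have "g (p i) \<in> snd ` block s A (e i) J" using C by blast
      then show "\<exists>x. (x, g (p i)) \<in> A \<and> x div s = e i" by (auto simp: block_def)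
    qed
    then obtain f where f: "\<And>i. i < k \<Longrightarrow> (f i, g (p i)) \<in> A \<and> f i div s = e i"
      by (metis lessThan_iff)
    have "strict_mono_on {..<k} f"
      using f by (intro strict_mono_on_if_div[OF e(2), of _ s]) auto
    then show False using nc f g unfolding mat_contains_def by blast
  qed
  have "card W = (\<Sum>D\<in>C ` W. card {I \<in> W. C I = D})"
    unfolding card_eq_sum by (rule sum.image_gen[OF finW])
  also have "\<dots> \<le> card (C ` W) * k" 
    using sum_bounded_above[of "C ` W" "\<lambda>D. card {I \<in> W. C I = D}" k] fib by simp
  also have "card (C ` W) \<le> 2 ^ s" using card_mono[OF _ CP] by (simp add: card_Pow)
  finally show ?thesis using finW by (simp add: mult.commute)
qed

text \<open>A block that is neither wide (\<open>W\<close>) nor tall (\<open>T\<close>) meets at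
  most \<open>k - 1\<close> rows and \<open>k - 1\<close> columns, hence has at most
  \<open>(k - 1)^2\<close> entries. Each of the \<open>n\<close> block columns and \<open>n\<close>
  block rows has at most \<open>k * 2 ^ s\<close> exceptional blocks, for which the trivial bound
  \<open>s^2\<close> suffices.\<close>

lemma card_le_contract:
  assumes p: "bij_betw p {..<k} {..<k}" and nc: "\<not> mat_contains k p A"
    and A: "A \<subseteq> {..<n * s} \<times> {..<n * s}" and "0 < k" "0 < s"
  shows "card A \<le> (k - 1)\<^sup>2 * card (contract s A) + 2 * k * 2 ^ s * s\<^sup>2 * n"
proof -
  have fin: "finite A" using A finite_subset by blast
  have p': "bij_betw (the_inv_into {..<k} p) {..<k} {..<k}" using p by (rule bij_betw_the_inv_into)
  have nc': "\<not> mat_contains k (the_inv_into {..<k} p) (A\<inverse>)" using mat_contains_converse[OF p] nc by blast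
  define W where "W J = {I. k \<le> card (snd ` block s A I J)}" for J
  define T where "T I = {J. k \<le> card (fst ` block s A I J)}" for I
  have W: "finite (W J) \<and> card (W J) \<le> k * 2 ^ s" for J
    unfolding W_def by (rule card_wide_blocks[OF p nc fin assms(4,5)])
  have "snd ` block s (A\<inverse>) I J = fst ` block s A J I" for I J
    by (force simp: block_def)
  then have T: "finite (T I) \<and> card (T I) \<le> k * 2 ^ s" for I
    unfolding T_def using card_wide_blocks[OF p' nc' _ assms(4,5), of I] fin by simp
  define Z where "Z = (\<lambda>(J, I). (I, J)) ` (SIGMA J:{..<n}. W J) \<union> (SIGMA I:{..<n}. T I)"
  have finZ: "finite Z" unfolding Z_def using W T by auto
  have "card Z \<le> card (SIGMA J:{..<n}. W J) + card (SIGMA I:{..<n}. T I)"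
    unfolding Z_def using W by (intro order.trans[OF card_Un_le] add_mono card_image_le) auto
  also have "\<dots> = (\<Sum>J<n. card (W J)) + (\<Sum>J<n. card (T J))" using W T by simp
  also have "\<dots> \<le> n * (k * 2 ^ s) + n * (k * 2 ^ s)"
    using W T by (intro add_mono order.trans[OF sum_bounded_above[where K = "k * 2 ^ s"]]) auto
  finally have cZ: "card Z \<le> 2 * k * 2 ^ s * n" by (simp add: algebra_simps)
  have bl: "card (block s A I J) \<le> (k - 1)\<^sup>2 + (if (I, J) \<in> Z then s\<^sup>2 else 0)"
    if IJ: "(I, J) \<in> contract s A" for I J
  proof (cases "(I, J) \<in> Z")
    case True
    have "card (block s A I J) \<le> s * s"
      using card_mono[OF _ block_subset[OF \<open>0 < s\<close>, of A I J]] by (simp add: card_cartesian_product)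
    then show ?thesis using True by (simp add: power2_eq_square)
  next
    case False
    have "I < n" "J < n" using IJ A by (auto simp: contract_def less_mult_imp_div_less)
    then have "I \<notin> W J" "J \<notin> T I" using False unfolding Z_def by (auto simp: image_iff)
    then have c: "card (snd ` block s A I J) \<le> k - 1" "card (fst ` block s A I J) \<le> k - 1"
      unfolding W_def T_def by auto
    have f: "finite (block s A I J)" using fin by (auto simp: block_def intro: finite_subset)
    have "block s A I J \<subseteq> fst ` block s A I J \<times> snd ` block s A I J" by force
    then have "card (block s A I J) \<le> card (fst ` block s A I J) * card (snd ` block s A I J)"
      using f by (metis card_cartesian_product card_mono finite_SigmaI finite_imageI)
    also have "\<dots> \<le> (k - 1)\<^sup>2" unfolding power2_eq_square using c by (intro mult_mono) auto
    finally show ?thesis by simp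
  qed
  have "A = (\<Union>b\<in>contract s A. block s A (fst b) (snd b))"
    by (auto simp: contract_def block_def)
  moreover have finC: "finite (contract s A)" using fin by (simp add: contract_def)
  ultimately have "card A \<le> (\<Sum>b\<in>contract s A. card (block s A (fst b) (snd b)))"
    by (metis card_UN_le)
  also have "\<dots> \<le> (\<Sum>b\<in>contract s A. (k - 1)\<^sup>2 + (if b \<in> Z then s\<^sup>2 else 0))"
    by (intro sum_mono) (use bl in \<open>metis prod.collapse\<close>)
  also have "\<dots> = (k - 1)\<^sup>2 * card (contract s A) + s\<^sup>2 * card (contract s A \<inter> Z)"
    using finC by (simp add: sum.distrib sum.If_cases)
  also have "card (contract s A \<inter> Z) \<le> 2 * k * 2 ^ s * n"
    using cZ finZ by (meson card_mono inf_le2 order_trans)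
  finally show ?thesis by (simp add: algebra_simps)
qed

lemma contract_subset:
  "A \<subseteq> {..<n * s} \<times> {..<n * s} \<Longrightarrow> contract s A \<subseteq> {..<n} \<times> {..<n}"
  by (auto simp: contract_def less_mult_imp_div_less)

text \<open>The block side \<open>k^2\<close> makes the linear bound reproduce itself with the same
  constant: contraction multiplies it by \<open>(k - 1)^2\<close>, the exceptional blocks add it
  once more, and \<open>(k - 1)^2 + 1 <= k^2\<close>.\<close>

theorem marcus_tardos:
  assumes p: "bij_betw p {..<k} {..<k}" and "0 < k" "\<not> mat_contains k p A"
    and "A \<subseteq> {..<(k\<^sup>2) ^ t} \<times> {..<(k\<^sup>2) ^ t}"
  shows "card A \<le> 2 * k * 2 ^ k\<^sup>2 * (k\<^sup>2)\<^sup>2 * (k\<^sup>2) ^ t"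
  using assms(3,4)
proof (induction t arbitrary: A)
  case 0
  have "card A \<le> 1" using card_mono[OF _ 0(2)] by (simp add: card_cartesian_product)
  also have "1 \<le> 2 * k * 2 ^ k\<^sup>2 * (k\<^sup>2)\<^sup>2 * (k\<^sup>2) ^ 0" using \<open>0 < k\<close> by simp
  finally show ?case .
next
  case (Suc t)
  let ?s = "k\<^sup>2" and ?K = "2 * k * 2 ^ k\<^sup>2 * (k\<^sup>2)\<^sup>2"
  have A: "A \<subseteq> {..<?s ^ t * ?s} \<times> {..<?s ^ t * ?s}" using Suc.prems(2) by (simp add: mult.commute)
  have "card A \<le> (k - 1)\<^sup>2 * card (contract ?s A) + ?K * ?s ^ t"
    using card_le_contract[OF p Suc.prems(1) A] \<open>0 < k\<close> by simp
  also have "card (contract ?s A) \<le> ?K * ?s ^ t"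
    using Suc.IH[OF _ contract_subset[OF A]] mat_contains_contract[OF p] Suc.prems(1) by blast
  also have "(k - 1)\<^sup>2 * (?K * ?s ^ t) + ?K * ?s ^ t = ((k - 1)\<^sup>2 + 1) * (?K * ?s ^ t)" by simp
  also have "(k - 1)\<^sup>2 + 1 \<le> k\<^sup>2" using \<open>0 < k\<close> by (cases k) (auto simp: power2_eq_square)
  finally show ?case by (simp add: algebra_simps)
qed

subsection \<open>The Stanley--Wilf bound\<close>

text \<open>Klazar's argument is run along powers of \<open>k\<^sup>2\<close>, so that the bound of Marcus and Tardos is
  needed at these sizes only.\<close>

definition avoiders :: "nat \<Rightarrow> (nat \<Rightarrow> nat) \<Rightarrow> nat \<Rightarrow> (nat \<times> nat) set set" where
  "avoiders k p n = {A. A \<subseteq> {..<n} \<times> {..<n} \<and> \<not> mat_contains k p A}"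

lemma finite_avoiders: "finite (avoiders k p n)"
  unfolding avoiders_def by (rule finite_subset[of _ "Pow ({..<n} \<times> {..<n})"]) auto

text \<open>\<open>A\<close> is determined by its contraction \<open>B\<close> together with a
  subset of the \<open>s^2 * card B\<close> cells lying over \<open>B\<close>, which bounds each
  fibre of \<open>contract s\<close>.\<close>

lemma card_avoiders_mult:
  assumes p: "bij_betw p {..<k} {..<k}" and "0 < s"
    and M: "\<And>B. B \<in> avoiders k p n \<Longrightarrow> card B \<le> M"
  shows "card (avoiders k p (n * s)) \<le> card (avoiders k p n) * 2 ^ (s\<^sup>2 * M)"
proof -
  have sub: "contract s ` avoiders k p (n * s) \<subseteq> avoiders k p n"
    using contract_subset mat_contains_contract[OF p] unfolding avoiders_def by blast
  have fib: "card {A \<in> avoiders k p (n * s). contract s A = B} \<le> 2 ^ (s\<^sup>2 * M)"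
    if "B \<in> avoiders k p n" for B
  proof -
    let ?U = "\<Union>(I, J)\<in>B. {I * s..<I * s + s} \<times> {J * s..<J * s + s}"
    have fB: "finite B" using that finite_subset unfolding avoiders_def by blast
    then have fU: "finite ?U" by auto
    have "card ?U \<le> (\<Sum>b\<in>B. card (case b of (I, J) \<Rightarrow> {I * s..<I * s + s} \<times> {J * s..<J * s + s}))"
      using card_UN_le[OF fB] .
    also have "\<dots> = s\<^sup>2 * card B"
      by (simp add: case_prod_beta card_cartesian_product power2_eq_square)
    also have "\<dots> \<le> s\<^sup>2 * M" using M[OF that] by simp
    finally have cU: "card ?U \<le> s\<^sup>2 * M" .
    have "{A \<in> avoiders k p (n * s). contract s A = B} \<subseteq> Pow ?U"
    proof clarify
      fix A x y assume "B = contract s A" "(x, y) \<in> A"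
      then have "(x div s, y div s) \<in> contract s A" "(x, y) \<in> block s A (x div s) (y div s)"
        by (auto simp: contract_def block_def)
      then show "(x, y) \<in> (\<Union>(I, J)\<in>contract s A. {I * s..<I * s + s} \<times> {J * s..<J * s + s})"
        using block_subset[OF \<open>0 < s\<close>] by blast
    qed
    then have "card {A \<in> avoiders k p (n * s). contract s A = B} \<le> 2 ^ card ?U"
      using card_mono[of "Pow ?U"] fU by (simp add: card_Pow)
    also have "\<dots> \<le> 2 ^ (s\<^sup>2 * M)" using cU by (intro power_increasing) auto
    finally show ?thesis .
  qed
  have "card (avoiders k p (n * s)) =
      (\<Sum>B\<in>contract s ` avoiders k p (n * s). card {A \<in> avoiders k p (n * s). contract s A = B})"
    unfolding card_eq_sum by (rule sum.image_gen[OF finite_avoiders])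
  also have "\<dots> \<le> card (contract s ` avoiders k p (n * s)) * 2 ^ (s\<^sup>2 * M)"
    using fib sub by (intro order.trans[OF sum_bounded_above[where K = "2 ^ (s\<^sup>2 * M)"]]) auto
  also have "\<dots> \<le> card (avoiders k p n) * 2 ^ (s\<^sup>2 * M)"
    using card_mono[OF finite_avoiders sub] by simp
  finally show ?thesis .
qed

lemma card_avoiders_power:
  assumes p: "bij_betw p {..<k} {..<k}" and "2 \<le> k"
  obtains D where "\<And>t. card (avoiders k p ((k\<^sup>2) ^ t)) \<le> 2 ^ (D * (k\<^sup>2) ^ t)"
proof
  define K where "K = 2 * k * 2 ^ k\<^sup>2 * (k\<^sup>2)\<^sup>2"
  \<comment> \<open>Passing from side \<open>N\<close> to \<open>k^2 * N\<close> adds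
    \<open>D * N\<close> to the exponent: at most \<open>K * N\<close> nonempty blocks with
    \<open>(k^2)^2\<close> cells each. The exponent thus at most doubles, which the growth of the
    side by \<open>k^2 >= 2\<close> pays for.\<close>
  define D where "D = (k\<^sup>2)\<^sup>2 * K"
  have s: "2 \<le> k\<^sup>2" using \<open>2 \<le> k\<close> self_le_power[of k 2] by simp
  have D: "1 \<le> D" using \<open>2 \<le> k\<close> by (simp add: D_def K_def Suc_le_eq)
  show "card (avoiders k p ((k\<^sup>2) ^ t)) \<le> 2 ^ (D * (k\<^sup>2) ^ t)" for t
  proof (induction t)
    case 0
    have "avoiders k p 1 \<subseteq> Pow {(0, 0)}" by (auto simp: avoiders_def)
    then have "card (avoiders k p 1) \<le> 2 ^ 1" using card_mono[of "Pow {(0::nat, 0::nat)}"] by (simp add: card_Pow)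
    also have "\<dots> \<le> 2 ^ D" using D by (intro power_increasing) auto
    finally show ?case by simp
  next
    case (Suc t)
    let ?N = "(k\<^sup>2) ^ t"
    have "card (avoiders k p (?N * k\<^sup>2)) \<le> card (avoiders k p ?N) * 2 ^ ((k\<^sup>2)\<^sup>2 * (K * ?N))"
      using marcus_tardos[OF p] \<open>2 \<le> k\<close>
      by (intro card_avoiders_mult[OF p]) (auto simp: avoiders_def K_def)
    also have "\<dots> \<le> 2 ^ (D * ?N) * 2 ^ ((k\<^sup>2)\<^sup>2 * (K * ?N))" using Suc by simp
    also have "\<dots> = 2 ^ (D * ?N * 2)" by (simp add: D_def power_add[symmetric] algebra_simps)
    also have "\<dots> \<le> 2 ^ (D * ?N * k\<^sup>2)" using s by (intro power_increasing) auto
    finally show ?case by (simp add: algebra_simps)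
  qed
qed

theorem stanley_wilf:
  assumes p: "bij_betw p {..<k} {..<k}" and "2 \<le> k"
  obtains C :: nat where
    "\<And>n. card {\<pi>. \<pi> permutes {1..n} \<and> \<not> mat_contains k p ((\<lambda>i. (i, \<pi> i)) ` {1..n})} \<le> C ^ n"
proof -
  obtain D where D: "\<And>t. card (avoiders k p ((k\<^sup>2) ^ t)) \<le> 2 ^ (D * (k\<^sup>2) ^ t)"
    using card_avoiders_power[OF assms] by blast
  have s: "1 < k\<^sup>2" using \<open>2 \<le> k\<close> by (intro one_less_power) auto
  have "card {\<pi>. \<pi> permutes {1..n} \<and> \<not> mat_contains k p ((\<lambda>i. (i, \<pi> i)) ` {1..n})}
      \<le> (2 ^ (D * k\<^sup>2)) ^ n" (is "card ?P \<le> _") for n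
  proof (cases "n = 0")
    case True
    then have "?P \<subseteq> {id}" by auto
    then show ?thesis using card_mono[of "{id}" ?P] True by simp
  next
    case False
    \<comment> \<open>Rounding \<open>n\<close> up to a power of \<open>k^2\<close> loses at most a
      factor \<open>k^2\<close> in the side, which is absorbed into the base of the
      exponential.\<close>
    define t where "t = (LEAST t. n < (k\<^sup>2) ^ t)"
    have ex: "n < (k\<^sup>2) ^ n" using s by (simp add: power_gt_expt)
    \<comment> \<open>The inequality is strict because positions and entries run from 1 to
      \<open>n\<close> while the grid is indexed from 0.\<close>
    have t: "n < (k\<^sup>2) ^ t" unfolding t_def using ex by (rule LeastI)
    then obtain u where u: "t = Suc u" using False by (cases t) auto
    have "\<not> n < (k\<^sup>2) ^ u" using not_less_Least[of u "\<lambda>t. n < (k\<^sup>2) ^ t"] u t_def by simp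
    then have le: "(k\<^sup>2) ^ t \<le> k\<^sup>2 * n" using u by simp
    have inj: "inj_on (\<lambda>\<pi>. (\<lambda>i. (i, \<pi> i)) ` {1..n}) ?P"
    proof (rule inj_onI)
      fix \<pi> \<sigma> assume a: "\<pi> \<in> ?P" "\<sigma> \<in> ?P" "(\<lambda>i. (i, \<pi> i)) ` {1..n} = (\<lambda>i. (i, \<sigma> i)) ` {1..n}"
      show "\<pi> = \<sigma>"
      proof
        fix i show "\<pi> i = \<sigma> i"
        proof (cases "i \<in> {1..n}")
          case True
          then have "(i, \<pi> i) \<in> (\<lambda>i. (i, \<sigma> i)) ` {1..n}" using a(3) by blast
          then show ?thesis by auto
        next
          case False
          then show ?thesis using a(1,2) by (auto simp: permutes_def)
        qed
      qed
    qed
    have sub: "(\<lambda>\<pi>. (\<lambda>i. (i, \<pi> i)) ` {1..n}) ` ?P \<subseteq> avoiders k p ((k\<^sup>2) ^ t)"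
    proof (clarsimp simp: avoiders_def)
      fix \<pi> i assume "\<pi> permutes {Suc 0..n}" "Suc 0 \<le> i" "i \<le> n"
      then have "\<pi> i \<in> {Suc 0..n}" using permutes_in_image[of \<pi> "{Suc 0..n}" i] by simp
      then show "i < (k\<^sup>2) ^ t \<and> \<pi> i < (k\<^sup>2) ^ t" using t \<open>i \<le> n\<close> by simp
    qed
    have "card ?P \<le> card (avoiders k p ((k\<^sup>2) ^ t))"
      using card_inj_on_le[OF inj sub finite_avoiders] .
    also have "\<dots> \<le> 2 ^ (D * (k\<^sup>2) ^ t)" by (rule D)
    also have "\<dots> \<le> 2 ^ (D * (k\<^sup>2 * n))" using le by (intro power_increasing) auto
    finally show ?thesis by (simp add: power_mult[symmetric] mult.assoc)
  qed
  then show ?thesis by (rule that)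
qed

subsection \<open>Fekete's lemma\<close>

lemma supermultiplicative_power_le:
  fixes a :: "nat \<Rightarrow> nat"
  assumes pos: "\<And>n. 1 \<le> a n" and super: "\<And>m n. a m * a n \<le> a (m + n)"
  shows "a m ^ (n div m) \<le> a n"
proof -
  have pw: "a m ^ q \<le> a (q * m)" for q
  proof (induction q)
    case (Suc q)
    have "a m ^ Suc q \<le> a m * a (q * m)" using Suc by simp
    also have "\<dots> \<le> a (Suc q * m)" using super[of m "q * m"] by simp
    finally show ?case .
  qed (use pos in simp)
  have "a m ^ (n div m) \<le> a (n div m * m) * a (n mod m)"
    using pw[of "n div m"] pos[of "n mod m"] by (metis mult.right_neutral mult_le_mono)
  also have "\<dots> \<le> a n" using super[of "n div m * m" "n mod m"] by simp
  finally show ?thesis .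
qed

lemma tendsto_div_over_nat:
  assumes "0 < m"
  shows "(\<lambda>n. real (n div m) / real n) \<longlonglongrightarrow> 1 / real m"
proof (rule tendsto_sandwich)
  show "\<forall>\<^sub>F n in sequentially. 1 / real m - 1 / real n \<le> real (n div m) / real n"
    using eventually_gt_at_top[of 0]
  proof eventually_elim
    case (elim n)
    have "real n \<le> real (m * (n div m) + m)"
      using dividend_less_times_div[OF assms, of n] by (intro of_nat_mono) simp
    then have "real n / real m - 1 \<le> real (n div m)" using assms by (simp add: field_simps)
    then have "(real n / real m - 1) / real n \<le> real (n div m) / real n"
      by (intro divide_right_mono) auto
    then show ?case using elim assms by (simp add: field_simps)
  qed
  show "\<forall>\<^sub>F n in sequentially. real (n div m) / real n \<le> 1 / real m"
    using eventually_gt_at_top[of 0]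
  proof eventually_elim
    case (elim n)
    have "real (n div m * m) \<le> real n" by (intro of_nat_mono) simp
    then have "real (n div m) \<le> real n / real m" using assms by (simp add: field_simps)
    then have "real (n div m) / real n \<le> (real n / real m) / real n"
      by (intro divide_right_mono) auto
    then show ?case using elim by simp
  qed
  show "(\<lambda>n. 1 / real m - 1 / real n) \<longlonglongrightarrow> 1 / real m"
    using tendsto_diff[OF tendsto_const lim_1_over_n, of "1 / real m"] by simp
qed simp

text \<open>The supremum is taken in \<open>ereal\<close>, so unbounded roots are covered too. If
  \<open>x\<close> lies below it, as witnessed by \<open>m\<close>, then \<open>a n\<close> is at
  least \<open>a m ^ (n div m)\<close>, and the n-th root of the latter tends to
  \<open>root m (a m)\<close>, which exceeds \<open>x\<close>.\<close>

lemma fekete_root: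
  fixes a :: "nat \<Rightarrow> nat"
  assumes pos: "\<And>n. 1 \<le> a n" and super: "\<And>m n. a m * a n \<le> a (m + n)"
  shows "(\<lambda>n. ereal (root n (real (a n)))) \<longlonglongrightarrow> (SUP n\<in>{1..}. ereal (root n (real (a n))))"
proof (rule increasing_tendsto)
  show "\<forall>\<^sub>F n in sequentially. ereal (root n (real (a n))) \<le> (SUP n\<in>{1..}. ereal (root n (real (a n))))"
    using eventually_ge_at_top[of 1] by eventually_elim (auto intro: SUP_upper)
next
  fix x assume "x < (SUP n\<in>{1..}. ereal (root n (real (a n))))"
  then obtain m where m: "0 < m" "x < ereal (root m (real (a m)))"
    unfolding less_SUP_iff by (metis atLeast_iff less_eq_Suc_le One_nat_def)
  have am: "0 < real (a m)" using pos[of m] by simp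
  have "(\<lambda>n. real (a m) powr (real (n div m) / real n)) \<longlonglongrightarrow> real (a m) powr (1 / real m)"
    using am by (intro tendsto_powr tendsto_const tendsto_div_over_nat m) auto
  then have "(\<lambda>n. ereal (real (a m) powr (real (n div m) / real n))) \<longlonglongrightarrow> ereal (root m (real (a m)))"
    using am m by (simp add: root_powr_inverse)
  from order_tendstoD(1)[OF this m(2)] eventually_gt_at_top[of 0]
  show "\<forall>\<^sub>F n in sequentially. x < ereal (root n (real (a n)))"
  proof eventually_elim
    case (elim n)
    have "real (a m) powr (real (n div m) / real n) = (real (a m) ^ (n div m)) powr (1 / real n)"
      using am by (simp add: powr_realpow[symmetric] powr_powr)
    also have "\<dots> = root n (real (a m ^ (n div m)))"
      using am elim by (simp add: root_powr_inverse)
    also have "\<dots> \<le> root n (real (a n))"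
      using supermultiplicative_power_le[OF pos super, of m n] elim
      by (intro real_root_le_mono of_nat_mono) auto
    finally show ?case using elim by (meson ereal_less_eq(3) less_le_trans)
  qed
qed

subsection \<open>Distant patterns\<close>

lemma finite_Av: "finite (Av n q)"
  unfolding Av_def by (rule finite_subset[OF _ finite_permutations[of "{1..n}"]]) auto

lemma Av_eq_if_no_room: "Av n q = {\<pi>. \<pi> permutes {1..n}}" if "n < len q"
proof -
  have "\<not> occurrence q n \<pi> x" for \<pi> x
  proof
    assume "occurrence q n \<pi> x"
    then have "inj_on x {1..len q}" "x ` {1..len q} \<subseteq> {1..n}"
      by (auto simp: occurrence_def strict_mono_on_imp_inj_on)
    then show False using card_inj_on_le[of x "{1..len q}" "{1..n}"] that by simp
  qed
  then show ?thesis by (simp add: Av_def)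
qed

section \<open>Outer gaps and windows of positions\<close>

definition trim :: "distant_pattern \<Rightarrow> distant_pattern" where
  "trim q = q\<lparr>gap := (gap q)(0 := 0, len q := 0)\<rparr>"

lemma trim_sel [simp]:
  "len (trim q) = len q" "letter (trim q) = letter q" "tight (trim q) = tight q"
  "gap (trim q) 0 = 0" "gap (trim q) (len q) = 0" "trim (trim q) = trim q"
  by (auto simp: trim_def)

lemma gap_trim: "i \<in> {1..<len q} \<Longrightarrow> gap (trim q) i = gap q i"
  by (auto simp: trim_def)

text \<open>Inner gaps depend only on differences of positions and survive the shift. Outer gaps may
  be filled by entries outside the window, which is why only \<open>trim q\<close> is
  obtained.\<close>

lemma occurrence_trim_shift:
  assumes q: "is_distant_pattern q" and occ: "occurrence q N \<tau> x"
    and x: "\<And>i. i \<in> {1..len q} \<Longrightarrow> x i \<in> {a + 1..a + m}"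
    and iso: "\<And>i j. i \<in> {1..m} \<Longrightarrow> j \<in> {1..m} \<Longrightarrow> \<pi> i < \<pi> j \<longleftrightarrow> \<tau> (a + i) < \<tau> (a + j)"
  shows "occurrence (trim q) m \<pi> (\<lambda>i. x i - a)"
proof -
  have t: "i \<in> {1..<len q}" if "i \<in> tight q" for i using q that by (auto simp: is_distant_pattern_def)
  have c: "card {x i - a<..<x (i + 1) - a} = card {x i<..<x (i + 1)}" if "i \<in> {1..<len q}" for i
    using x[of i] x[of "i + 1"] that by auto
  have "strict_mono_on {1..len q} (\<lambda>i. x i - a)"
  proof (rule strict_mono_onI)
    fix i j assume ij: "i \<in> {1..len q}" "j \<in> {1..len q}" "i < j"
    then have "x i < x j" using occ by (simp add: occurrence_def strict_mono_on_def)
    then show "x i - a < x j - a" using x[OF ij(1)] by auto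
  qed
  moreover have "(\<lambda>i. x i - a) ` {1..len q} \<subseteq> {1..m}" using x by fastforce
  moreover have "\<pi> (x i - a) < \<pi> (x j - a) \<longleftrightarrow> letter q i < letter q j"
    if "i \<in> {1..len q}" "j \<in> {1..len q}" for i j
  proof -
    have "\<pi> (x i - a) < \<pi> (x j - a) \<longleftrightarrow> \<tau> (x i) < \<tau> (x j)"
      using iso[of "x i - a" "x j - a"] x[OF that(1)] x[OF that(2)] by (auto simp: le_diff_conv2 le_diff_conv add.commute)
    then show ?thesis using occ that by (simp add: occurrence_def)
  qed
  moreover have "\<forall>i\<in>{1..<len q}. gap (trim q) i \<le> card {x i - a<..<x (i + 1) - a}"
    using occ c gap_trim by (simp add: occurrence_def del: card_greaterThanLessThan)
  moreover have "\<forall>i\<in>tight q. card {x i - a<..<x (i + 1) - a} = gap (trim q) i"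
    using occ c[OF t] gap_trim[OF t] by (simp add: occurrence_def del: card_greaterThanLessThan)
  ultimately show ?thesis
    unfolding occurrence_def trim_sel by blast
qed

text \<open>The positions on the two sides of the window are exactly as many as the outer gaps of
  \<open>q\<close> demand, wherever the occurrence lies inside the window.\<close>

lemma occurrence_untrim:
  assumes q: "is_distant_pattern q" and occ: "occurrence (trim q) m \<pi> x"
    and iso: "\<And>i j. i \<in> {1..m} \<Longrightarrow> j \<in> {1..m} \<Longrightarrow>
      \<pi> i < \<pi> j \<longleftrightarrow> \<tau> (gap q 0 + i) < \<tau> (gap q 0 + j)"
  shows "occurrence q (gap q 0 + m + gap q (len q)) \<tau> (\<lambda>i. gap q 0 + x i)"
proof -
  have t: "i \<in> {1..<len q}" if "i \<in> tight q" for i using q that by (auto simp: is_distant_pattern_def)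
  have k: "1 \<in> {1..len q}" "len q \<in> {1..len q}" using q by (auto simp: is_distant_pattern_def)
  have x: "x i \<in> {1..m}" if "i \<in> {1..len q}" for i
    using occ that by (auto simp: occurrence_def image_subset_iff simp del: atLeastAtMost_iff)
  have c: "card {gap q 0 + x i<..<gap q 0 + x (i + 1)} = card {x i<..<x (i + 1)}" for i
    by simp
  have "strict_mono_on {1..len q} (\<lambda>i. gap q 0 + x i)"
    using occ by (auto simp: occurrence_def strict_mono_on_def)
  moreover have "(\<lambda>i. gap q 0 + x i) ` {1..len q} \<subseteq> {1..gap q 0 + m + gap q (len q)}"
    using x by fastforce
  moreover have "\<tau> (gap q 0 + x i) < \<tau> (gap q 0 + x j) \<longleftrightarrow> letter q i < letter q j"
    if "i \<in> {1..len q}" "j \<in> {1..len q}" for i j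
    using iso[OF x[OF that(1)] x[OF that(2)]] occ that by (simp add: occurrence_def)
  moreover have "gap q 0 \<le> card {1..<gap q 0 + x 1}" using x[OF k(1)] by auto
  moreover have "gap q (len q) \<le> card {gap q 0 + x (len q)<..gap q 0 + m + gap q (len q)}"
    using x[OF k(2)] by auto
  moreover have "\<forall>i\<in>{1..<len q}. gap q i \<le> card {x i<..<x (i + 1)}"
    using occ gap_trim by (simp add: occurrence_def del: card_greaterThanLessThan)
  moreover have "\<forall>i\<in>tight q. card {x i<..<x (i + 1)} = gap q i"
    using occ gap_trim[OF t] by (simp add: occurrence_def del: card_greaterThanLessThan)
  ultimately show ?thesis
    unfolding occurrence_def c by blast
qed

lemma card_Av_trim_le:
  assumes "is_distant_pattern q"
  shows "card (Av n (trim q)) \<le> card (Av n q)"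
proof (rule card_mono[OF finite_Av])
  have "occurrence (trim q) n \<pi> x" if "occurrence q n \<pi> x" for \<pi> x
    using occurrence_trim_shift[OF assms that, of 0 n \<pi>] that by (auto simp: occurrence_def image_subset_iff)
  then show "Av n (trim q) \<subseteq> Av n q" unfolding Av_def by blast
qed

section \<open>Ranks and standardization of a window\<close>

lemma card_le_less_iff:
  fixes S :: "nat set"
  assumes "finite S" "u \<in> S" "v \<in> S"
  shows "card {w \<in> S. w \<le> u} < card {w \<in> S. w \<le> v} \<longleftrightarrow> u < v"
proof -
  have "card {w \<in> S. w \<le> u} < card {w \<in> S. w \<le> v}" if "u < v"
  proof (rule psubset_card_mono)
    have "v \<in> {w \<in> S. w \<le> v}" "v \<notin> {w \<in> S. w \<le> u}" using assms that by auto
    then show "{w \<in> S. w \<le> u} \<subset> {w \<in> S. w \<le> v}" using that by fastforce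
  qed (use assms in simp)
  moreover have "card {w \<in> S. w \<le> v} \<le> card {w \<in> S. w \<le> u}" if "v \<le> u"
    using assms that by (intro card_mono) auto
  ultimately show ?thesis by (meson not_less)
qed

lemma card_le_inj:
  fixes S :: "nat set"
  assumes "finite S" "u \<in> S" "v \<in> S" "card {w \<in> S. w \<le> u} = card {w \<in> S. w \<le> v}"
  shows "u = v"
  using card_le_less_iff[OF assms(1-3)] card_le_less_iff[OF assms(1,3,2)] assms(4) by simp

lemma permutes_if_inj_into:
  assumes "inj_on f S" "f ` S \<subseteq> S" "finite S" "\<And>x. x \<notin> S \<Longrightarrow> f x = x"
  shows "f permutes S"
  using assms by (intro bij_imp_permutes bij_betw_imageI endo_inj_surj)

text \<open>The rank of an entry among the values in the window; the identity elsewhere, as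
  \<open>permutes\<close> demands.\<close>

definition standardize :: "nat \<Rightarrow> nat \<Rightarrow> (nat \<Rightarrow> nat) \<Rightarrow> nat \<Rightarrow> nat" where
  "standardize a m \<pi> i =
     (if i \<in> {1..m} then card {v \<in> \<pi> ` {a + 1..a + m}. v \<le> \<pi> (a + i)} else i)"

lemma standardize_less_iff:
  assumes "i \<in> {1..m}" "j \<in> {1..m}"
  shows "standardize a m \<pi> i < standardize a m \<pi> j \<longleftrightarrow> \<pi> (a + i) < \<pi> (a + j)"
  using assms by (simp add: standardize_def card_le_less_iff)

lemma standardize_permutes:
  assumes "inj \<pi>"
  shows "standardize a m \<pi> permutes {1..m}"
proof (rule permutes_if_inj_into)
  show "inj_on (standardize a m \<pi>) {1..m}"
  proof (rule inj_onI)
    fix i j assume ij: "i \<in> {1..m}" "j \<in> {1..m}" "standardize a m \<pi> i = standardize a m \<pi> j"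
    then have "\<pi> (a + i) = \<pi> (a + j)"
      using standardize_less_iff[of i m j a \<pi>] standardize_less_iff[of j m i a \<pi>] by simp
    then show "i = j" using injD[OF assms] by fastforce
  qed
  show "standardize a m \<pi> ` {1..m} \<subseteq> {1..m}"
  proof
    fix y assume "y \<in> standardize a m \<pi> ` {1..m}"
    then obtain i where i: "i \<in> {1..m}" "y = card {v \<in> \<pi> ` {a + 1..a + m}. v \<le> \<pi> (a + i)}"
      by (auto simp: standardize_def)
    have "card {v \<in> \<pi> ` {a + 1..a + m}. v \<le> \<pi> (a + i)} \<le> card (\<pi> ` {a + 1..a + m})"
      by (intro card_mono) auto
    also have "\<dots> \<le> m" using card_image_le[of "{a + 1..a + m}" \<pi>] by simp
    finally have "y \<le> m" using i by simp
    moreover have "\<pi> (a + i) \<in> {v \<in> \<pi> ` {a + 1..a + m}. v \<le> \<pi> (a + i)}" using i by auto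
    then have "y \<noteq> 0" unfolding i(2) by (subst card_0_eq) (simp, blast)
    ultimately show "y \<in> {1..m}" by simp
  qed
qed (auto simp: standardize_def)

text \<open>A permutation is recovered from the entries in the \<open>a + b\<close> outer positions
  and the standardized window: the former leave over the set of values in the window, the latter
  gives their order.\<close>

lemma card_Av_le_trim:
  assumes q: "is_distant_pattern q"
  defines "a \<equiv> gap q 0" and "b \<equiv> gap q (len q)"
  shows "card (Av (a + m + b) q) \<le> card (Av m (trim q)) * (a + m + b) ^ (a + b)"
proof -
  let ?N = "a + m + b"
  let ?O = "{1..?N} - {a + 1..a + m}"
  let ?F = "\<lambda>\<pi>. (standardize a m \<pi>, restrict \<pi> ?O)"
  have inj: "inj_on ?F (Av ?N q)"
  proof (rule inj_onI)
    fix \<pi> \<sigma> assume mem: "\<pi> \<in> Av ?N q" "\<sigma> \<in> Av ?N q" and eq: "?F \<pi> = ?F \<sigma>"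
    have per: "\<pi> permutes {1..?N}" "\<sigma> permutes {1..?N}" using mem by (auto simp: Av_def)
    have out: "\<pi> i = \<sigma> i" if "i \<in> ?O" for i
      using eq that by (metis Pair_inject restrict_apply')
    have img: "\<tau> ` {a + 1..a + m} = {1..?N} - \<tau> ` ?O" if "\<tau> permutes {1..?N}" for \<tau>
    proof -
      have "{a + 1..a + m} = {1..?N} - ?O" by auto
      then have "\<tau> ` {a + 1..a + m} = \<tau> ` {1..?N} - \<tau> ` ?O"
        using image_set_diff[OF permutes_inj[OF that]] by metis
      then show ?thesis using permutes_image[OF that] by simp
    qed
    have "\<pi> ` ?O = \<sigma> ` ?O" using out by (rule image_cong[OF refl])
    then have S: "\<sigma> ` {a + 1..a + m} = \<pi> ` {a + 1..a + m}" using img per by metis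
    have "\<pi> (a + i) = \<sigma> (a + i)" if i: "i \<in> {1..m}" for i
    proof -
      let ?S = "\<pi> ` {a + 1..a + m}"
      have "standardize a m \<pi> i = standardize a m \<sigma> i" using eq by simp
      then have eqc: "card {v \<in> ?S. v \<le> \<pi> (a + i)} = card {v \<in> ?S. v \<le> \<sigma> (a + i)}"
        using i unfolding standardize_def S by simp
      have "a + i \<in> {a + 1..a + m}" using i by auto
      then have "\<pi> (a + i) \<in> ?S" "\<sigma> (a + i) \<in> ?S" using S by blast+
      from card_le_inj[OF _ this eqc] show ?thesis by blast
    qed
    note inside = this
    show "\<pi> = \<sigma>"
    proof
      fix i
      consider "i \<in> ?O" | "i \<in> {a + 1..a + m}" | "i \<notin> {1..?N}" by blast
      then show "\<pi> i = \<sigma> i"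
      proof cases
        case 2
        then have "i - a \<in> {1..m}" "a + (i - a) = i" by auto
        then show ?thesis using inside[of "i - a"] by simp
      qed (use out per in \<open>auto simp: permutes_def\<close>)
    qed
  qed
  have sub: "?F ` Av ?N q \<subseteq> Av m (trim q) \<times> (?O \<rightarrow>\<^sub>E {1..?N})"
  proof
    fix z assume "z \<in> ?F ` Av ?N q"
    then obtain \<pi> where \<pi>: "\<pi> \<in> Av ?N q" "z = ?F \<pi>" by blast
    then have per: "\<pi> permutes {1..?N}" by (simp add: Av_def)
    have "\<not> occurrence (trim q) m (standardize a m \<pi>) x" for x
      using occurrence_untrim[OF q, of m "standardize a m \<pi>" x \<pi>] \<pi>(1)
      unfolding a_def b_def Av_def by (auto simp: standardize_less_iff)
    then have "standardize a m \<pi> \<in> Av m (trim q)"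
      using standardize_permutes[OF permutes_inj[OF per]] by (simp add: Av_def)
    moreover have "restrict \<pi> ?O \<in> ?O \<rightarrow>\<^sub>E {1..?N}"
      using permutes_in_image[OF per] by (intro restrict_PiE_iff[THEN iffD2]) blast
    ultimately show "z \<in> Av m (trim q) \<times> (?O \<rightarrow>\<^sub>E {1..?N})" using \<pi> by blast
  qed
  have cO: "card ?O = a + b" by (subst card_Diff_subset) auto
  have "card (Av ?N q) \<le> card (Av m (trim q) \<times> (?O \<rightarrow>\<^sub>E {1..?N}))"
    by (rule card_inj_on_le[OF inj sub]) (intro finite_cartesian_product finite_Av finite_PiE; simp)
  also have "\<dots> = card (Av m (trim q)) * ?N ^ (a + b)"
    using cO by (simp add: card_cartesian_product card_PiE)
  finally show ?thesis .
qed

section \<open>Sums of avoiders\<close>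

text \<open>With \<open>(u, v) = (0, m)\<close> this is the direct sum and with \<open>(u, v) = (n, 0)\<close> the skew sum.\<close>

definition glue :: "nat \<Rightarrow> nat \<Rightarrow> nat \<Rightarrow> nat \<Rightarrow> (nat \<Rightarrow> nat) \<Rightarrow> (nat \<Rightarrow> nat) \<Rightarrow> nat \<Rightarrow> nat" where
  "glue m n u v \<pi> \<sigma> i =
     (if i \<in> {1..m} then u + \<pi> i else if i \<in> {m + 1..m + n} then v + \<sigma> (i - m) else i)"

lemma glue_permutes:
  assumes \<pi>: "\<pi> permutes {1..m}" and \<sigma>: "\<sigma> permutes {1..n}"
    and uv: "u = 0 \<and> v = m \<or> u = n \<and> v = 0"
  shows "glue m n u v \<pi> \<sigma> permutes {1..m + n}"
proof (rule permutes_if_inj_into)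
  have l: "\<pi> i \<in> {1..m}" if "i \<in> {1..m}" for i using \<pi> that by (simp add: permutes_in_image del: atLeastAtMost_iff)
  have r: "\<sigma> (i - m) \<in> {1..n}" if "i \<in> {m + 1..m + n}" for i
    using permutes_in_image[OF \<sigma>, of "i - m"] that by auto
  have sl: "glue m n u v \<pi> \<sigma> i = u + \<pi> i" if "i \<in> {1..m}" for i using that by (simp add: glue_def)
  have sr: "glue m n u v \<pi> \<sigma> i = v + \<sigma> (i - m)" if "i \<in> {m + 1..m + n}" for i
    using that by (simp add: glue_def)
  have split: "{1..m + n} = {1..m} \<union> {m + 1..m + n}" by auto
  have "inj_on (glue m n u v \<pi> \<sigma>) {1..m}"
    by (rule inj_onI) (metis sl add_left_imp_eq injD permutes_inj[OF \<pi>])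
  moreover have "inj_on (glue m n u v \<pi> \<sigma>) {m + 1..m + n}"
  proof (rule inj_onI)
    fix i j assume ij: "i \<in> {m + 1..m + n}" "j \<in> {m + 1..m + n}"
      and "glue m n u v \<pi> \<sigma> i = glue m n u v \<pi> \<sigma> j"
    then have "\<sigma> (i - m) = \<sigma> (j - m)" using sr by simp
    then have "i - m = j - m" by (rule injD[OF permutes_inj[OF \<sigma>]])
    then show "i = j" using ij by auto
  qed
  moreover have "glue m n u v \<pi> \<sigma> i \<noteq> glue m n u v \<pi> \<sigma> j" if "i \<in> {1..m}" "j \<in> {m + 1..m + n}" for i j
    using l[OF that(1)] r[OF that(2)] sl[OF that(1)] sr[OF that(2)] uv by auto
  ultimately show "inj_on (glue m n u v \<pi> \<sigma>) {1..m + n}"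
    unfolding split by (subst inj_on_Un) blast
  show "glue m n u v \<pi> \<sigma> ` {1..m + n} \<subseteq> {1..m + n}"
  proof clarify
    fix i assume "i \<in> {1..m + n}"
    then consider "i \<in> {1..m}" | "i \<in> {m + 1..m + n}" unfolding split by blast
    then show "glue m n u v \<pi> \<sigma> i \<in> {1..m + n}"
      using l[of i] r[of i] sl[of i] sr[of i] uv by cases auto
  qed
qed (auto simp: glue_def)

text \<open>The order of the first and the last letter of \<open>q\<close> tells which of the two sums cannot have
  an occurrence of \<open>q\<close> that meets both summands.\<close>

lemma Av_trim_supermultiplicative:
  assumes q: "is_distant_pattern q" and len: "2 \<le> len q"
  shows "card (Av m (trim q)) * card (Av n (trim q)) \<le> card (Av (m + n) (trim q))"
proof -
  let ?k = "len q"
  have tq: "is_distant_pattern (trim q)" using q by (simp add: is_distant_pattern_def)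
  have k: "1 \<in> {1..?k}" "?k \<in> {1..?k}" using len by auto
  \<comment> \<open>If \<open>q\<close> ends below its start, the direct sum is taken: there a first
    letter on the left is below a last letter on the right. Otherwise the skew sum reverses
    this.\<close>
  define u where "u = (if letter q ?k < letter q 1 then 0 else n)"
  define v where "v = (if letter q ?k < letter q 1 then m else 0)"
  let ?G = "\<lambda>(\<pi>, \<sigma>). glue m n u v \<pi> \<sigma>"
  have inj: "inj_on ?G (Av m (trim q) \<times> Av n (trim q))"
  proof (rule inj_onI, clarify)
    fix \<pi> \<sigma> \<pi>' \<sigma>'
    assume mem: "\<pi> \<in> Av m (trim q)" "\<sigma> \<in> Av n (trim q)" "\<pi>' \<in> Av m (trim q)" "\<sigma>' \<in> Av n (trim q)"
      and eq: "glue m n u v \<pi> \<sigma> = glue m n u v \<pi>' \<sigma>'"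
    have "\<pi> i = \<pi>' i" for i
      using fun_cong[OF eq, of i] mem
      by (cases "i \<in> {1..m}") (auto simp: glue_def Av_def permutes_def)
    moreover have "\<sigma> i = \<sigma>' i" for i
      using fun_cong[OF eq, of "m + i"] mem
      by (cases "i \<in> {1..n}") (auto simp: glue_def Av_def permutes_def)
    ultimately show "\<pi> = \<pi>' \<and> \<sigma> = \<sigma>'" by blast
  qed
  have "glue m n u v \<pi> \<sigma> \<in> Av (m + n) (trim q)"
    if mem: "\<pi> \<in> Av m (trim q)" "\<sigma> \<in> Av n (trim q)" for \<pi> \<sigma>
  proof -
    have per: "\<pi> permutes {1..m}" "\<sigma> permutes {1..n}" using mem by (auto simp: Av_def)
    have "\<not> occurrence (trim q) (m + n) (glue m n u v \<pi> \<sigma>) x" for x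
    proof
      assume occ: "occurrence (trim q) (m + n) (glue m n u v \<pi> \<sigma>) x"
      have x: "x i \<in> {1..m + n}" if "i \<in> {1..?k}" for i 
        using occ that by (auto simp: occurrence_def image_subset_iff simp del: atLeastAtMost_iff)
      have mono: "x i \<le> x j" if "i \<in> {1..?k}" "j \<in> {1..?k}" "i \<le> j" for i j
        using occ that strict_mono_on_leD by (fastforce simp: occurrence_def)
      consider "x ?k \<le> m" | "m < x 1" | "x 1 \<le> m" "m < x ?k" by linarith
      then show False
      proof cases
        case 1
        have "occurrence (trim (trim q)) m \<pi> (\<lambda>i. x i - 0)"
        proof (rule occurrence_trim_shift[OF tq occ])
          show "x i \<in> {0 + 1..0 + m}" if "i \<in> {1..len (trim q)}" for i
            using x[of i] mono[OF _ k(2), of i] that 1 by auto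
        qed (auto simp: glue_def)
        then show False using mem(1) by (auto simp: Av_def)
      next
        case 2
        have "occurrence (trim (trim q)) n \<sigma> (\<lambda>i. x i - m)"
        proof (rule occurrence_trim_shift[OF tq occ])
          show "x i \<in> {m + 1..m + n}" if "i \<in> {1..len (trim q)}" for i
            using x[of i] mono[OF k(1), of i] that 2 by auto
        qed (auto simp: glue_def)
        then show False using mem(2) by (auto simp: Av_def)
      next
        case 3
        have b: "x 1 \<in> {1..m}" "x ?k \<in> {m + 1..m + n}" using 3 x[OF k(1)] x[OF k(2)] by auto
        have "\<pi> (x 1) \<in> {1..m}" using permutes_in_image[OF per(1), of "x 1"] b by blast
        moreover have "\<sigma> (x ?k - m) \<in> {1..n}"
          using permutes_in_image[OF per(2), of "x ?k - m"] b by auto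
        moreover have "glue m n u v \<pi> \<sigma> (x 1) = u + \<pi> (x 1)"
          "glue m n u v \<pi> \<sigma> (x ?k) = v + \<sigma> (x ?k - m)"
          using b by (auto simp: glue_def)
        moreover have "glue m n u v \<pi> \<sigma> (x 1) < glue m n u v \<pi> \<sigma> (x ?k) \<longleftrightarrow> letter q 1 < letter q ?k"
          using occ k by (simp add: occurrence_def)
        moreover have "letter q 1 \<noteq> letter q ?k"
          using q len injD[OF permutes_inj[of "letter q" "{1..?k}"], of 1 ?k] by (auto simp: is_distant_pattern_def)
        ultimately show False by (auto simp: u_def v_def split: if_splits)
      qed
    qed
    then show ?thesis using glue_permutes[OF per] by (auto simp: Av_def u_def v_def)
  qed
  then have sub: "?G ` (Av m (trim q) \<times> Av n (trim q)) \<subseteq> Av (m + n) (trim q)" by auto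
  show ?thesis using card_inj_on_le[OF inj sub finite_Av] by (simp add: card_cartesian_product)
qed

text \<open>An avoider is built by adding single entries with the sum construction; one entry is too
  short to contain \<open>q\<close>.\<close>

lemma card_Av_trim_pos:
  assumes q: "is_distant_pattern q" and len: "2 \<le> len q"
  shows "1 \<le> card (Av n (trim q))"
proof (induction n)
  case 0
  show ?case using len by (subst Av_eq_if_no_room) auto
next
  case (Suc n)
  have "card (Av 1 (trim q)) = 1"
    using len by (subst Av_eq_if_no_room) (auto simp: card_permutations[of "{1}" 1])
  then show ?case using Suc Av_trim_supermultiplicative[OF assms, of 1 n] by simp
qed

section \<open>Finite growth for classical patterns\<close>

text \<open>A classical \<open>q\<close> occurs wherever its inflation by long increasing runs does: the first
  entries of the runs are far enough apart.\<close>

lemma card_Av_trim_classical: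
  assumes q: "is_distant_pattern q" and len: "2 \<le> len q" and cl: "classical q"
  obtains C :: nat where "\<And>n. card (Av n (trim q)) \<le> C ^ n"
proof -
  let ?k = "len q"
  \<comment> \<open>Larger than every gap, so that the \<open>M - 1\<close> later entries of a run
    can fill the gap after its first entry.\<close>
  define M where "M = Suc (\<Sum>i\<le>?k. gap q i)"
  have M: "0 < M" by (simp add: M_def)
  have gM: "gap q i < M" if "i \<le> ?k" for i
    using member_le_sum[of i "{..?k}" "gap q"] that by (simp add: M_def less_Suc_eq_le)
  have per: "letter q permutes {1..?k}" using q by (simp add: is_distant_pattern_def)
  have lin: "letter q i \<in> {1..?k}" if "i \<in> {1..?k}" for i using permutes_in_image[OF per] that by blast
  \<comment> \<open>The inflation of \<open>q\<close> with indices from 0: \<open>c\<close> is entry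
    \<open>c mod M\<close> of run \<open>c div M\<close>. The run occupies the block of values
    belonging to its letter and keeps the offset, so it increases. The shifts by 1 translate to
    letters counted from 1.\<close>
  define p where "p c = (letter q (c div M + 1) - 1) * M + c mod M" for c
  have blk: "c div M + 1 \<in> {1..?k}" if "c < ?k * M" for c
    using that by (simp add: less_mult_imp_div_less Suc_le_eq)
  have pdiv: "p c div M = letter q (c div M + 1) - 1" "p c mod M = c mod M" for c
    using M by (simp_all add: p_def)
  have "inj_on p {..<?k * M}"
  proof (rule inj_onI)
    fix c d assume cd: "c \<in> {..<?k * M}" "d \<in> {..<?k * M}" "p c = p d"
    have "letter q (c div M + 1) - 1 = letter q (d div M + 1) - 1" using cd(3) pdiv(1) by metis
    moreover have "1 \<le> letter q (c div M + 1)" "1 \<le> letter q (d div M + 1)"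
      using lin[OF blk] cd(1,2) by auto
    ultimately have "letter q (c div M + 1) = letter q (d div M + 1)" by simp
    then have "c div M = d div M" using injD[OF permutes_inj[OF per]] by fastforce
    moreover have "c mod M = d mod M" using cd(3) pdiv(2) by metis
    ultimately show "c = d" by (metis div_mult_mod_eq)
  qed
  moreover have "p ` {..<?k * M} \<subseteq> {..<?k * M}"
  proof clarify
    fix c assume "c < ?k * M"
    then have "p c div M < ?k" unfolding pdiv using lin[OF blk] by fastforce
    then show "p c < ?k * M" using M by (simp add: div_less_iff_less_mult)
  qed
  ultimately have p: "bij_betw p {..<?k * M} {..<?k * M}"
    by (intro bij_betw_imageI endo_inj_surj) auto
  have "2 \<le> ?k * M" using len M by (metis One_nat_def Suc_leI mult.right_neutral mult_le_mono)
  then obtain C where C: "\<And>n. card {\<pi>. \<pi> permutes {1..n} \<and>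
      \<not> mat_contains (?k * M) p ((\<lambda>i. (i, \<pi> i)) ` {1..n})} \<le> C ^ n"
    using stanley_wilf[OF p] by blast
  have "\<exists>x. occurrence (trim q) n \<pi> x"
    if contains: "mat_contains (?k * M) p ((\<lambda>i. (i, \<pi> i)) ` {1..n})" for n \<pi>
  proof -
    obtain f g where f: "strict_mono_on {..<?k * M} f" and g: "strict_mono_on {..<?k * M} g"
      and fg: "\<forall>i<?k * M. (f i, g (p i)) \<in> (\<lambda>i. (i, \<pi> i)) ` {1..n}"
      using contains by (rule mat_containsE)
    define x where "x i = f ((i - 1) * M)" for i
    have ib: "(i - 1) * M < ?k * M" if "i \<in> {1..?k}" for i using that M by auto
    have pi: "p ((i - 1) * M) = (letter q i - 1) * M" if "i \<in> {1..?k}" for i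
      using that M by (simp add: p_def)
    have "strict_mono_on {1..?k} x"
    proof (rule strict_mono_onI)
      fix i j assume ij: "i \<in> {1..?k}" "j \<in> {1..?k}" "i < j"
      then have "(i - 1) * M < (j - 1) * M" using M by auto
      then show "x i < x j" using f ib[OF ij(1)] ib[OF ij(2)] by (auto simp: x_def strict_mono_on_def)
    qed
    moreover have "x ` {1..?k} \<subseteq> {1..n}" using fg[rule_format, OF ib] by (fastforce simp: x_def)
    moreover have "\<pi> (x i) < \<pi> (x j) \<longleftrightarrow> letter q i < letter q j"
      if ij: "i \<in> {1..?k}" "j \<in> {1..?k}" for i j
    proof -
      have \<pi>x: "\<pi> (x i) = g ((letter q i - 1) * M)" if "i \<in> {1..?k}" for i
        using fg[rule_format, OF ib[OF that]] pi[OF that] by (auto simp: x_def)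
      have lb: "(letter q i - 1) * M \<in> {..<?k * M}" if "i \<in> {1..?k}" for i
        using ib[OF lin[OF that]] by simp
      have "\<pi> (x i) < \<pi> (x j) \<longleftrightarrow> (letter q i - 1) * M < (letter q j - 1) * M"
        using \<pi>x ij strict_mono_on_less[OF g lb[OF ij(1)] lb[OF ij(2)]] by simp
      also have "\<dots> \<longleftrightarrow> letter q i < letter q j" using lin[OF ij(1)] lin[OF ij(2)] M by auto
      finally show ?thesis .
    qed
    moreover have "gap (trim q) i \<le> card {x i<..<x (i + 1)}" if i: "i \<in> {1..<?k}" for i
    proof -
      \<comment> \<open>The indices of the other \<open>M - 1\<close> entries of run
        \<open>i\<close>; \<open>f\<close> sends them to distinct positions strictly between
        \<open>x i\<close> and \<open>x (i + 1)\<close>.\<close>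
      let ?R = "{(i - 1) * M<..<i * M}"
      have R: "?R \<subseteq> {..<?k * M}" "i * M < ?k * M" using i M by (auto intro: less_trans)
      have "i * M - (i - 1) * M = M" using i by (cases i) auto
      then have "gap (trim q) i \<le> card ?R" using gM[of i] i gap_trim[OF i] by simp
      also have "\<dots> = card (f ` ?R)"
        using inj_on_subset[OF strict_mono_on_imp_inj_on[OF f] R(1)] by (simp add: card_image)
      also have "f ` ?R \<subseteq> {x i<..<x (i + 1)}"
        using f R ib[of i] i by (auto simp: x_def strict_mono_on_def)
      then have "card (f ` ?R) \<le> card {x i<..<x (i + 1)}" by (intro card_mono) auto
      finally show ?thesis .
    qed
    \<comment> \<open>Only lower bounds on the gaps have been shown; with no tight gap nothing more
      is required.\<close>
    ultimately have "occurrence (trim q) n \<pi> x"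
      using cl by (simp add: occurrence_def classical_def del: card_greaterThanLessThan)
    then show ?thesis by blast
  qed
  then have "Av n (trim q) \<subseteq>
      {\<pi>. \<pi> permutes {1..n} \<and> \<not> mat_contains (?k * M) p ((\<lambda>i. (i, \<pi> i)) ` {1..n})}" for n
    unfolding Av_def by blast
  then have "card (Av n (trim q)) \<le> C ^ n" for n
    by (rule order.trans[OF card_mono C, rotated])
      (rule finite_subset[OF _ finite_permutations[of "{1..n}"]], auto)
  then show ?thesis by (rule that)
qed

text \<open>A pattern of length 1 occurs in every sufficiently long permutation, so its roots tend
  to 0; this is what \<open>2 <= len q\<close> excludes. The limit lives in \<open>ereal\<close>
  because vincular patterns can have superexponentially many avoiders: for 123 with one tight gap
  and all gap sizes 0 they are counted by the Bell numbers.\<close>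

theorem theorem7p1:
  fixes q :: distant_pattern
  assumes "is_distant_pattern q" and "2 \<le> len q"
  shows "\<exists>c :: ereal. 0 < c \<and> (classical q \<longrightarrow> c < \<infinity>) \<and>
           (\<lambda>n. ereal (root n (real (card (Av n q))))) \<longlonglongrightarrow> c"
proof -
  define a where "a n = card (Av n (trim q))" for n
  define R where "R = gap q 0 + gap q (len q)"
  define c where "c = (SUP n\<in>{1..}. ereal (root n (real (a n))))"
  have pos: "1 \<le> a n" and super: "a m * a n \<le> a (m + n)" for m n
    using card_Av_trim_pos[OF assms] Av_trim_supermultiplicative[OF assms] by (auto simp: a_def)
  have lim: "(\<lambda>n. ereal (root n (real (a n)))) \<longlonglongrightarrow> c"
    unfolding c_def by (rule fekete_root[OF pos super])
  have "ereal (root 1 (real (a 1))) \<le> c" unfolding c_def by (rule SUP_upper) simp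
  moreover have "0 < ereal (root 1 (real (a 1)))" using pos[of 1] by simp
  ultimately have c: "0 < c" by (rule less_le_trans[rotated])
  have fin: "c < \<infinity>" if "classical q"
  proof -
    obtain C where C: "\<And>n. a n \<le> C ^ n"
      using card_Av_trim_classical[OF assms \<open>classical q\<close>] unfolding a_def by metis
    have "root n (real (a n)) \<le> real C" if "1 \<le> n" for n
    proof -
      have "root n (real (a n)) \<le> root n (real C ^ n)"
        using C[of n] that by (intro real_root_le_mono) (auto simp flip: of_nat_power)
      then show ?thesis using that by (simp add: real_root_power_cancel)
    qed
    then have "c \<le> ereal (real C)" unfolding c_def by (intro SUP_least) auto
    then show ?thesis by (rule le_less_trans) simp
  qed
  have "(\<lambda>n. root n (real n) ^ R) \<longlonglongrightarrow> 1 ^ R" by (intro tendsto_power LIMSEQ_root)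
  then have "(\<lambda>n. ereal (root n (real n) ^ R)) \<longlonglongrightarrow> ereal 1" by simp
  \<comment> \<open>The limit of the product avoids the critical case of 0 times infinity:
    \<open>c\<close> may be infinite, but the other factor tends to 1.\<close>
  from tendsto_mult_ereal[OF lim this] c
  have up: "(\<lambda>n. ereal (root n (real (a n))) * ereal (root n (real n) ^ R)) \<longlonglongrightarrow> c"
    by (simp flip: one_ereal_def)
  have "(\<lambda>n. ereal (root n (real (card (Av n q))))) \<longlonglongrightarrow> c"
  proof (rule tendsto_sandwich[OF _ _ lim up])
    show "\<forall>\<^sub>F n in sequentially. ereal (root n (real (a n))) \<le> ereal (root n (real (card (Av n q))))"
      using eventually_gt_at_top[of 0]
      by eventually_elim (simp add: a_def card_Av_trim_le[OF assms(1)])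
    show "\<forall>\<^sub>F n in sequentially. ereal (root n (real (card (Av n q))))
        \<le> ereal (root n (real (a n))) * ereal (root n (real n) ^ R)"
      using eventually_ge_at_top[of "Suc R"]
    proof eventually_elim
      case (elim n)
      have n: "n = gap q 0 + (n - R) + gap q (len q)" using elim by (simp add: R_def)
      \<comment> \<open>Moving from \<open>a (n - R)\<close> to \<open>a n\<close> lets the upper
        bound use the same index as the root, so no shifted sequence has to be compared.\<close>
      have "a (n - R) \<le> a (n - R) * a R" using pos[of R] by simp
      also have "\<dots> \<le> a n" using super[of "n - R" R] elim by simp
      finally have "a (n - R) * n ^ R \<le> a n * n ^ R" by simp
      moreover have "card (Av n q) \<le> a (n - R) * n ^ R"
        using card_Av_le_trim[OF assms(1), of "n - R"] n by (simp add: a_def R_def)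
      ultimately have "card (Av n q) \<le> a n * n ^ R" by (rule order.trans[rotated])
      then have "real (card (Av n q)) \<le> real (a n) * real n ^ R"
        by (simp flip: of_nat_power of_nat_mult)
      then have "root n (real (card (Av n q))) \<le> root n (real (a n) * real n ^ R)"
        using elim by simp
      also have "\<dots> = root n (real (a n)) * root n (real n) ^ R"
        using elim by (simp add: real_root_mult real_root_power)
      finally show ?case by simp
    qed
  qed
  then show ?thesis using c fin by blast
qed

end
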